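(* Let $f(X)\in\mathbb{F}_q[X]$ ($q=p^e$, $p$ prime) be nonconstant and coprime to $X$, with irreducible factorization $f=f_1^{h_1}\cdots f_t^{h_t}$, where $f_1,\dots,f_t$ are pairwise distinct irreducible polynomials and $h_i\geq1$. Let $m$ be the order of $\mathrm{rad}(f)=f_1\cdots f_t$, and for $1\le i\le t$ let $c_{m/q}(\gamma_i)$ (with $\gamma_i$ an integer) be the $q$-cyclotomic coset modulo $m$ defining $f_i$, i.e. $f_i=a_i\prod_{\eta\in c_{m/q}(\gamma_i)}(X-\zeta_m^{\eta})$ for some $a_i\in\mathbb{F}_q^{\ast}$. Let $u$ be the smallest integer such that $p^{u}\geq h_i$ for all $i$, let $d_i=\gamma_{i+1}-\gamma_i$ for $1\le i\le t-1$, and let $d_f=\gcd(d_1,\dots,d_{t-1},m,q-1)$. Then the minimal binomial order of $f$ is $p^{u}\cdot\frac{m}{d_f}$, and the minimal binomial multiple of $f$ is $$X^{\frac{p^{u}m}{d_f}}-\zeta_m^{\frac{p^{u}\gamma m}{d_f}},$$ where $\gamma$ can be chosen to be any $\gamma_i$, $1\le i\le t$.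
   Context: The order of a polynomial $g$ coprime to $X$ is the least positive $m$ with $g\mid X^m-1$. $\{\zeta_n:\gcd(n,q)=1\}$ is a fixed compatible family of primitive $n$-th roots of unity ($\zeta_n^{n/m}=\zeta_m$ for $m\mid n$). The $q$-cyclotomic coset modulo $m$ containing $\gamma$ is $c_{m/q}(\gamma)=\{\gamma,\gamma q,\gamma q^2,\dots\}\subseteq\mathbb{Z}/m\mathbb{Z}$. A binomial is $X^n-\lambda$ with $n\ge1$, $\lambda\in\mathbb{F}_q^\ast$. The minimal binomial multiple of a nonconstant polynomial $f$ with nonzero constant term is the monic binomial $X^n-\lambda\in\mathbb{F}_q[X]$ of least degree that is divisible by $f$; its degree $n$ is the minimal binomial order $\mathrm{ord}^{\mathrm b}(f)$. *)

theory Defs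
  imports "HOL-Algebra.Algebraic_Closure_Type" "HOL-Library.Cardinality"
begin

(* Only meaningful for nonzero g coprime to X; the least value exists by poly_ord_exists. *)
definition poly_ord :: "'a::{field,finite} poly \<Rightarrow> nat" where
  "poly_ord g = (LEAST m. 0 < m \<and> g dvd [:0, 1:] ^ m - 1)"

definition primitive_root_of_unity :: "nat \<Rightarrow> 'b::field \<Rightarrow> bool" where
  "primitive_root_of_unity n z \<longleftrightarrow>
     0 < n \<and> z ^ n = 1 \<and> (\<forall>k. 0 < k \<and> k < n \<longrightarrow> z ^ k \<noteq> 1)"

definition compatible_roots_of_unity :: "nat \<Rightarrow> (nat \<Rightarrow> 'b::field) \<Rightarrow> bool" where
  "compatible_roots_of_unity q \<zeta> \<longleftrightarrow>
     (\<forall>n. coprime n q \<longrightarrow> primitive_root_of_unity n (\<zeta> n)) \<and>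
     (\<forall>n m. coprime n q \<longrightarrow> m dvd n \<longrightarrow> \<zeta> n ^ (n div m) = \<zeta> m)"

(* Residue classes modulo m are represented by their representatives in {0..<m}. *)
definition cyclotomic_coset :: "nat \<Rightarrow> nat \<Rightarrow> int \<Rightarrow> int set" where
  "cyclotomic_coset q m \<gamma> = {(\<gamma> * int q ^ j) mod int m | j. True}"

definition binomial_poly :: "'a::field poly \<Rightarrow> bool" where
  "binomial_poly g \<longleftrightarrow> (\<exists>n c. 1 \<le> n \<and> c \<noteq> 0 \<and> g = [:0, 1:] ^ n - [:c:])"

definition is_min_binomial_multiple :: "'a::field poly \<Rightarrow> 'a poly \<Rightarrow> bool" where
  "is_min_binomial_multiple f g \<longleftrightarrow>
     binomial_poly g \<and> f dvd g \<and>
     (\<forall>g'. binomial_poly g' \<and> f dvd g' \<longrightarrow> degree g \<le> degree g')"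

(* Well defined by is_min_binomial_multiple_ex1. *)
definition min_binomial_multiple :: "'a::{field,finite} poly \<Rightarrow> 'a poly" where
  "min_binomial_multiple f = (THE g. is_min_binomial_multiple f g)"

definition min_binomial_order :: "'a::{field,finite} poly \<Rightarrow> nat" where
  "min_binomial_order f = degree (min_binomial_multiple f)"

lemma finite_polys_degree_le: "finite {g :: 'a::{field,finite} poly. degree g \<le> n}"
proof (rule finite_subset)
  show "{g :: 'a poly. degree g \<le> n} \<subseteq> Poly ` {xs. set xs \<subseteq> UNIV \<and> length xs = Suc n}"
  proof
    fix g :: "'a poly" assume "g \<in> {g. degree g \<le> n}"
    then have "g = Poly (map (poly.coeff g) [0..<Suc n])"
      by (intro poly_eqI)
        (auto simp: nth_default_def coeff_eq_0 simp del: upt_Suc)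
    then show "g \<in> Poly ` {xs. set xs \<subseteq> UNIV \<and> length xs = Suc n}"
      by (intro image_eqI) auto
  qed
  show "finite (Poly ` {xs :: 'a list. set xs \<subseteq> UNIV \<and> length xs = Suc n})"
    by (intro finite_imageI finite_lists_length_eq) simp
qed

lemma dvd_mult_X_power_cancel:
  fixes g r :: "'a::field poly"
  assumes "coprime g [:0, 1:]" and "g dvd r * [:0, 1:] ^ i"
  shows "g dvd r"
  using assms(2)
proof (induction i)
  case (Suc i)
  let ?s = "r * [:0, 1:] ^ i"
  obtain c g' where g: "g = pCons c g'"
    by (cases g)
  have "c \<noteq> 0"
  proof
    assume "c = 0"
    then have "[:0, 1:] dvd g"
      by (simp add: g flip: poly_eq_0_iff_dvd[of _ 0, simplified])
    then have "[:0, 1:] dvd (1 :: 'a poly)"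
      using assms(1) by (simp add: coprime_def)
    then show False
      using dvd_imp_degree_le[of "[:0, 1:]" "1 :: 'a poly"] by simp
  qed
  have "smult c ?s = g * ?s - (?s * [:0, 1:]) * g'"
    by (simp add: g algebra_simps)
  moreover have "g dvd ?s * [:0, 1:]"
    using Suc.prems by (simp add: ac_simps)
  ultimately have "g dvd smult c ?s"
    by (simp only: dvd_diff dvd_triv_left dvd_mult2)
  with \<open>c \<noteq> 0\<close> show ?case
    using Suc.IH by (simp add: dvd_smult_iff)
qed simp

lemma poly_ord_exists:
  fixes g :: "'a::{field,finite} poly"
  assumes "g \<noteq> 0" and "coprime g [:0, 1:]"
  shows "\<exists>m>0. g dvd [:0, 1:] ^ m - 1"
proof -
  let ?h = "\<lambda>k::nat. ([:0, 1:] :: 'a poly) ^ k mod g"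
  have "range ?h \<subseteq> {r. degree r \<le> degree g}"
  proof (rule image_subsetI)
    fix k show "?h k \<in> {r. degree r \<le> degree g}"
      using degree_mod_less[OF assms(1), of "[:0, 1:] ^ k"] by (cases "?h k = 0") auto
  qed
  then have "finite (range ?h)"
    using finite_polys_degree_le finite_subset by blast
  then have "\<not> inj ?h"
    using finite_imageD infinite_UNIV_nat by blast
  then obtain i j where "i < j" and "?h i = ?h j"
    unfolding inj_def by (metis linorder_neqE_nat)
  then have "g dvd [:0, 1:] ^ j - [:0, 1:] ^ i"
    by (metis mod_eq_dvd_iff)
  also have "([:0, 1:] :: 'a poly) ^ j - [:0, 1:] ^ i = ([:0, 1:] ^ (j - i) - 1) * [:0, 1:] ^ i"
    using \<open>i < j\<close> by (simp add: left_diff_distrib flip: power_add)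
  finally have "g dvd [:0, 1:] ^ (j - i) - 1"
    using dvd_mult_X_power_cancel assms(2) by blast
  then show ?thesis
    using \<open>i < j\<close> by (intro exI[of _ "j - i"]) simp
qed

lemma degree_binomial:
  assumes "1 \<le> n"
  shows "degree ([:0, 1:] ^ n - [:c:] :: 'a::field poly) = n"
proof -
  have "degree ([:0, 1:] ^ n :: 'a poly) = n"
    by (simp add: degree_power_eq)
  then show ?thesis
    using assms degree_add_eq_left[of "- [:c:]" "[:0, 1:] ^ n"]
    by (simp only: diff_conv_add_uminus) simp
qed

lemma is_min_binomial_multiple_ex1:
  fixes f :: "'a::{field,finite} poly"
  assumes "0 < degree f" and "coprime f [:0, 1:]"
  shows "\<exists>!g. is_min_binomial_multiple f g"
proof -
  obtain m where "m > 0" "f dvd [:0, 1:] ^ m - 1"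
    using poly_ord_exists[of f] assms by fastforce
  then have "binomial_poly ([:0, 1:] ^ m - [:1::'a:])" "f dvd [:0, 1:] ^ m - [:1:]"
    unfolding binomial_poly_def by (auto simp: one_pCons intro!: exI[of _ m] exI[of _ "1::'a"])
  then have "\<exists>g. binomial_poly g \<and> f dvd g"
    by blast
  from ex_has_least_nat[of "\<lambda>g. binomial_poly g \<and> f dvd g" _ degree] this
  obtain g where g: "is_min_binomial_multiple f g"
    unfolding is_min_binomial_multiple_def by blast
  have "h = h'" if mins: "is_min_binomial_multiple f h" "is_min_binomial_multiple f h'" for h h'
  proof -
    obtain n c where h: "1 \<le> n" "h = [:0, 1:] ^ n - [:c:]"
      using mins(1) unfolding is_min_binomial_multiple_def binomial_poly_def by blast
    obtain n' c' where h': "1 \<le> n'" "h' = [:0, 1:] ^ n' - [:c':]"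
      using mins(2) unfolding is_min_binomial_multiple_def binomial_poly_def by blast
    have "degree h = degree h'"
      using mins unfolding is_min_binomial_multiple_def by (meson antisym)
    then have "n = n'"
      using h h' by (simp add: degree_binomial)
    have "f dvd h - h'"
      using mins unfolding is_min_binomial_multiple_def by (meson dvd_diff)
    then have "f dvd [:c' - c:]"
      using h(2) h'(2) \<open>n = n'\<close> by simp
    then have "c' = c"
      using assms(1) dvd_imp_degree_le[of f "[:c' - c:]"] by fastforce
    then show "h = h'"
      using h(2) h'(2) \<open>n = n'\<close> by simp
  qed
  with g show ?thesis
    by blast
qed

end

(* Write n = p^v k with p not dividing k. Since Frobenius is bijective on F_q, a binomial X^n - a is
   the p^v-th power of X^k - b with b in F_q, and X^k - b is squarefree. So f divides X^n - a iff
   h_i <= p^v for all i and rad f divides X^k - b. The latter says zeta_m^(gamma_i k) = b for all i;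
   hence m divides every k d_i, and it divides k (q - 1) because X^k - b divides X^(k (q - 1)) - 1.
   Thus m / d_f divides k. Conversely, d_f divides all gamma_i - gamma_j and q - 1, so
   zeta_m^(gamma_i m / d_f) is independent of i and lies in F_q. *)
theory Submission
  imports Defs "HOL-Number_Theory.Residues"
begin

lemma to_ac_poly_diff: "map_poly to_ac (g - h) = map_poly to_ac g - map_poly to_ac h"
  by (rule poly_eqI) (simp add: coeff_map_poly)

lemma to_ac_poly_mult: "map_poly to_ac (g * h) = map_poly to_ac g * map_poly to_ac h"
  by (rule poly_eqI) (simp add: coeff_map_poly coeff_mult to_ac_sum)

lemma to_ac_poly_power: "map_poly to_ac (g ^ n) = map_poly to_ac g ^ n"
  by (induction n) (simp_all add: to_ac_poly_mult)

lemma to_ac_poly_X_power_minus: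
  "map_poly to_ac ([:0, 1:] ^ n - [:c:]) = [:0, 1:] ^ n - [:to_ac c:]"
  by (simp add: to_ac_poly_diff to_ac_poly_power map_poly_pCons)

text \<open>The minimal polynomial of the common root divides both polynomials, and it is associated
  to the irreducible one.\<close>
lemma irreducible_dvd_if_common_root:
  fixes F g :: "'a::field poly"
  assumes "irreducible F" and "poly (map_poly to_ac F) x = 0" and "poly (map_poly to_ac g) x = 0"
  shows "F dvd g"
proof -
  let ?P = "\<lambda>r :: 'a poly. r \<noteq> 0 \<and> poly (map_poly to_ac r) x = 0"
  have "?P F"
    using assms by auto
  then obtain r where r: "?P r" and min: "\<And>s. ?P s \<Longrightarrow> degree r \<le> degree s"
    using ex_has_least_nat[of ?P F degree] by blast
  have dvd: "r dvd s" if "poly (map_poly to_ac s) x = 0" for s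
  proof (rule ccontr)
    assume "\<not> r dvd s"
    then have "degree (s mod r) < degree r" "s mod r \<noteq> 0"
      using r degree_mod_less_degree by (auto simp: dvd_eq_mod_eq_0)
    moreover have "poly (map_poly to_ac (s mod r)) x = 0"
      using r that by (simp add: to_ac_poly_diff to_ac_poly_mult flip: minus_mult_div_eq_mod)
    ultimately show False
      using min by (meson leD)
  qed
  have "\<not> is_unit r"
    using r by (auto simp: is_unit_poly_iff map_poly_pCons)
  then have "F dvd r"
    using irreducibleD'[OF assms(1) dvd[OF assms(2)]] by blast
  then show ?thesis
    using dvd[OF assms(3)] dvd_trans by blast
qed

text \<open>Induction on \<open>A\<close>: the prime \<open>F x\<close> divides none of the other
  factors, hence not the product of their powers, so the whole power \<open>F x ^ h x\<close> must
  divide the cofactor \<open>k\<close>.\<close>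

lemma prod_prime_elem_power_dvd:
  fixes g :: "'b::algebraic_semidom"
  assumes "finite A"
    and "\<And>i. i \<in> A \<Longrightarrow> prime_elem (F i)"
    and "\<And>i j. i \<in> A \<Longrightarrow> j \<in> A \<Longrightarrow> i \<noteq> j \<Longrightarrow> \<not> F i dvd F j"
    and "\<And>i. i \<in> A \<Longrightarrow> F i ^ h i dvd g"
  shows "(\<Prod>i\<in>A. F i ^ h i) dvd g"
  using assms
proof (induction A rule: finite_induct)
  case (insert x A)
  have "(\<Prod>i\<in>A. F i ^ h i) dvd g"
    using insert by auto
  then obtain k where k: "g = (\<Prod>i\<in>A. F i ^ h i) * k"
    by blast
  have prime: "prime_elem (F x)"
    using insert.prems by simp
  have "\<not> F x dvd (\<Prod>i\<in>A. F i ^ h i)"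
  proof
    assume "F x dvd (\<Prod>i\<in>A. F i ^ h i)"
    with insert.hyps(1) have "\<exists>i\<in>A. F x dvd F i ^ h i"
      using prime_elem_not_unit[OF prime]
      by (induction A rule: finite_induct) (auto simp: prime_elem_dvd_mult_iff[OF prime])
    then obtain i where "i \<in> A" "F x dvd F i ^ h i"
      by blast
    then show False
      using prime_elem_dvd_power[OF prime] insert.prems(2)[of x i] insert.hyps(2) by auto
  qed
  moreover have "F x ^ h x dvd (\<Prod>i\<in>A. F i ^ h i) * k"
    using insert.prems(3)[of x] k by simp
  ultimately have "F x ^ h x dvd k"
    using prime_power_dvd_multD[OF prime] by (metis gr0I power_0 one_dvd)
  then show ?case
    using insert.hyps k by (simp add: mult.commute mult_dvd_mono)
qed simp

text \<open>If \<open>n > k\<close>, then \<open>P ^ (k + 1)\<close> divides \<open>g ^ k\<close>.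
  Writing \<open>g = P * g'\<close> and cancelling \<open>P ^ k\<close> shows that \<open>P\<close>
  divides \<open>g'\<close>, so that \<open>P ^ 2\<close> divides \<open>g\<close>.\<close>

lemma prime_elem_power_dvd_power_le:
  fixes g :: "'b::algebraic_semidom"
  assumes "prime_elem P" and "\<not> P ^ 2 dvd g" and "P ^ n dvd g ^ k"
  shows "n \<le> k"
proof (rule ccontr)
  assume "\<not> n \<le> k"
  then have "P ^ Suc k dvd g ^ k"
    using assms(3) by (meson not_less_eq_eq power_le_dvd)
  then have "P dvd g ^ k"
    by (simp add: dvd_mult_left)
  then obtain g' where g': "g = P * g'"
    using prime_elem_dvd_power[OF assms(1)] by blast
  have "P ^ k * P dvd P ^ k * g' ^ k"
    using \<open>P ^ Suc k dvd g ^ k\<close> by (simp add: g' power_mult_distrib mult.commute)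
  then have "P dvd g' ^ k"
    using assms(1) by (simp add: prime_elem_not_zeroI)
  then have "P dvd g'"
    using prime_elem_dvd_power[OF assms(1)] by blast
  then show False
    using assms(2) by (simp add: g' power2_eq_square mult_dvd_mono)
qed

text \<open>If \<open>P ^ 2\<close> divides the binomial \<open>?g\<close>, then \<open>P\<close>
  divides both \<open>?g\<close> and its derivative, hence also
  \<open>X * pderiv ?g - n * ?g = n * c\<close>, a nonzero constant.\<close>

lemma square_not_dvd_X_power_minus:
  fixes P :: "'a::field poly"
  assumes "prime_elem P" and "of_nat n \<noteq> (0 :: 'a)" and "c \<noteq> 0"
  shows "\<not> P ^ 2 dvd [:0, 1:] ^ n - [:c:]"
proof
  let ?g = "[:0, 1:] ^ n - [:c:]"
  assume sq: "P ^ 2 dvd ?g"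
  then obtain s where "?g = P ^ 2 * s"
    by blast
  then have "pderiv ?g = P * (2 * pderiv P * s + P * pderiv s)"
    by (simp add: pderiv_mult power2_eq_square algebra_simps)
  then have "P dvd pderiv ?g"
    by simp
  moreover have "P dvd ?g"
    using sq by (meson dvd_power dvd_trans pos2)
  ultimately have "P dvd [:0, 1:] * pderiv ?g - of_nat n * ?g"
    by (metis dvd_diff dvd_mult)
  also have "[:0, 1:] * pderiv ?g - of_nat n * ?g = [:of_nat n * c:]"
  proof (cases n)
    case (Suc k)
    have "pderiv ?g = smult (of_nat n) ([:0, 1:] ^ k)"
      unfolding Suc pderiv_diff pderiv_power_Suc by (simp add: pderiv_pCons)
    then show ?thesis
      by (simp add: Suc of_nat_poly algebra_simps)
  qed (use assms(2) in simp)
  finally show False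
    using assms by (metis is_unit_triv mult_eq_0_iff dvd_trans prime_elem_not_unit)
qed

text \<open>Additivity of the Frobenius power is applied to \<open>(x - y) + y\<close>, which leaves
  no sign to determine.\<close>

lemma power_char_diff:
  fixes x y :: "'b::comm_ring_1"
  assumes "prime CHAR('b)"
  shows "(x - y) ^ (CHAR('b) ^ v) = x ^ (CHAR('b) ^ v) - y ^ (CHAR('b) ^ v)"
  using freshmans_dream'[OF assms refl, of "x - y" y v] by simp

text \<open>The iterated Frobenius map is injective on a field, hence onto a finite one. This
  supplies \<open>p ^ v\<close>-th roots of constants inside the base field.\<close>

lemma surj_power_char:
  assumes "prime CHAR('a::{field,finite})"
  shows "surj (\<lambda>x::'a. x ^ (CHAR('a) ^ v))"
proof (rule finite_UNIV_inj_surj[OF finite injI])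
  fix x y :: 'a assume "x ^ (CHAR('a) ^ v) = y ^ (CHAR('a) ^ v)"
  then have "(x - y) ^ (CHAR('a) ^ v) = 0"
    using power_char_diff[OF assms, of x y v] by simp
  then show "x = y"
    by simp
qed

text \<open>Multiplication by \<open>x\<close> permutes the nonzero elements, so their product is
  unchanged by the factor \<open>x ^ (CARD('a) - 1)\<close>.\<close>

lemma power_card_field:
  fixes x :: "'a::{field,finite}"
  assumes "x \<noteq> 0"
  shows "x ^ (CARD('a) - 1) = 1"
proof -
  have "bij_betw ((*) x) (- {0}) (- {0})"
    using assms by (intro bij_betwI[where g = "\<lambda>y. y / x"]) auto
  then have "(\<Prod>y\<in>- {0}. x * y) = \<Prod>(- {0})"
    by (rule prod.reindex_bij_betw)
  moreover have "(\<Prod>y\<in>- {0}. x * y) = x ^ (CARD('a) - 1) * \<Prod>(- {0})"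
    by (simp add: prod.distrib Compl_eq_Diff_UNIV)
  moreover have "\<Prod>(- {0 :: 'a}) \<noteq> 0"
    by simp
  ultimately show ?thesis
    by simp
qed

text \<open>The nonzero elements of the base field already exhaust the roots of \<open>X ^ (q - 1) - 1\<close>.\<close>
lemma in_range_to_ac_if_power_eq_1:
  fixes x :: "'a::{field,finite} alg_closure"
  assumes "x ^ (CARD('a) - 1) = 1"
  shows "x \<in> range to_ac"
proof -
  let ?g = "[:0, 1:] ^ (CARD('a) - 1) - [:1 :: 'a alg_closure:]"
  have card: "1 \<le> CARD('a) - 1"
    using card_mono[of UNIV "{0, 1 :: 'a}"] by simp
  then have deg: "degree ?g = CARD('a) - 1"
    by (rule degree_binomial)
  then have "?g \<noteq> 0"
    using card by (metis degree_0 not_one_le_zero)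
  moreover have sub: "to_ac ` (- {0}) \<subseteq> {x. poly ?g x = 0}"
    by (auto simp: power_card_field[unfolded One_nat_def] simp flip: to_ac_power)
  moreover have "card (to_ac ` (- {0 :: 'a})) = CARD('a) - 1"
    by (simp add: card_image inj_on_subset[OF inj_to_ac] Compl_eq_Diff_UNIV)
  ultimately have "to_ac ` (- {0}) = {x. poly ?g x = 0}"
    using deg by (metis card_poly_roots_bound card_seteq poly_roots_finite)
  moreover have "x \<in> {x. poly ?g x = 0}"
    using assms by simp
  ultimately show ?thesis
    by blast
qed

lemma CHAR_eq_if_card_eq_prime_power:
  assumes "prime p" and "CARD('a::{field,finite}) = p ^ e"
  shows "CHAR('a) = p"
proof -
  have "CHAR('a) dvd p ^ e"
    using CHAR_dvd_CARD[where ?'a = 'a] assms(2) by simp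
  moreover have "prime CHAR('a)"
    by (simp add: prime_CHAR_semidom finite_imp_CHAR_pos)
  ultimately show ?thesis
    using assms(1) by (meson prime_dvd_power primes_dvd_imp_eq)
qed

text \<open>Division with remainder: \<open>g\<close> divides \<open>X ^ (?m * a) - 1\<close> for
  every \<open>a\<close>, so it also divides \<open>X ^ (k mod ?m) - 1\<close>, and minimality of
  the order forces this remainder to be 0.\<close>

lemma
  fixes g :: "'a::{field,finite} poly"
  assumes "g \<noteq> 0" and "coprime g [:0, 1:]"
  shows poly_ord_pos: "0 < poly_ord g" and poly_ord_dvd_iff: "g dvd [:0, 1:] ^ k - 1 \<longleftrightarrow> poly_ord g dvd k"
proof -
  let ?X = "[:0, 1:] :: 'a poly" and ?m = "poly_ord g"
  have m: "0 < ?m \<and> g dvd ?X ^ ?m - 1"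
    using poly_ord_exists[OF assms] unfolding poly_ord_def by (rule LeastI_ex)
  show "0 < ?m"
    using m by simp
  have mult: "g dvd ?X ^ (?m * a) - 1" for a
  proof -
    have "?X ^ ?m - 1 dvd (?X ^ ?m) ^ a - 1"
      by (simp add: power_diff_1_eq)
    then show ?thesis
      using m dvd_trans by (simp only: power_mult) blast
  qed
  show "g dvd ?X ^ k - 1 \<longleftrightarrow> ?m dvd k"
  proof
    assume "g dvd ?X ^ k - 1"
    moreover have "?X ^ k - 1 = ?X ^ (k mod ?m) * (?X ^ (?m * (k div ?m)) - 1) + (?X ^ (k mod ?m) - 1)"
      by (simp add: right_diff_distrib flip: power_add)
    ultimately have "g dvd ?X ^ (k mod ?m) - 1"
      using mult[of "k div ?m"] by (metis dvd_add_right_iff dvd_mult)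
    then have "k mod ?m = 0"
      using m not_less_Least[of "k mod ?m" "\<lambda>m. 0 < m \<and> g dvd ?X ^ m - 1"]
      unfolding poly_ord_def by auto
    then show "?m dvd k"
      by auto
  qed (use mult in auto)
qed

text \<open>Exponents are integers because the \<open>\<gamma> i\<close> are. Reduction modulo
  \<open>n\<close> leaves an exponent in \<open>{0..<n}\<close>, where primitivity excludes
  everything but 0.\<close>

lemma primitive_root_powi_eq_1_iff:
  assumes "primitive_root_of_unity n z"
  shows "z powi k = 1 \<longleftrightarrow> int n dvd k"
proof -
  have n: "0 < n" "z ^ n = 1" and min: "\<And>k. 0 < k \<Longrightarrow> k < n \<Longrightarrow> z ^ k \<noteq> 1"
    using assms by (auto simp: primitive_root_of_unity_def)
  then have "z \<noteq> 0"
    by (auto simp: power_0_left)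
  have "z powi k = z powi (int n * (k div int n) + k mod int n)"
    by simp
  also have "\<dots> = z powi (k mod int n)"
    using \<open>z \<noteq> 0\<close> n by (subst power_int_add) (auto simp: power_int_mult)
  also have "\<dots> = z ^ nat (k mod int n)"
    using n by (simp add: power_int_nonneg_exp)
  finally have "z powi k = 1 \<longleftrightarrow> z ^ nat (k mod int n) = 1"
    by simp
  also have "\<dots> \<longleftrightarrow> k mod int n = 0"
  proof
    assume "z ^ nat (k mod int n) = 1"
    moreover have "nat (k mod int n) < n"
      using n(1) by (simp add: nat_less_iff)
    ultimately have "nat (k mod int n) = 0"
      using min by blast
    then show "k mod int n = 0"
      using n(1) pos_mod_sign[of "int n" k] by linarith
  qed simp
  finally show ?thesis
    by (simp add: dvd_eq_mod_eq_0)
qed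

lemma primitive_root_powi_eq_iff:
  assumes "primitive_root_of_unity n z"
  shows "z powi k = z powi l \<longleftrightarrow> int n dvd k - l"
proof -
  have "z \<noteq> 0"
    using assms by (auto simp: primitive_root_of_unity_def power_0_left)
  then show ?thesis
    by (simp add: power_int_diff flip: primitive_root_powi_eq_1_iff[OF assms])
qed

theorem theorem11:
  fixes f :: "'a::{field,finite} poly" and F :: "nat \<Rightarrow> 'a poly"
    and p e q t m u :: nat and h :: "nat \<Rightarrow> nat"
    and lc :: 'a and \<gamma> :: "nat \<Rightarrow> int" and d :: int
    and \<zeta> :: "nat \<Rightarrow> 'a alg_closure"
  assumes "prime p" and "q = p ^ e" and "CARD('a) = q"
    and "compatible_roots_of_unity q \<zeta>"
    and "0 < degree f" and "coprime f [:0, 1:]"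
    and "lc \<noteq> 0" and "f = smult lc (\<Prod>i\<in>{1..t}. F i ^ h i)"
    and "\<forall>i\<in>{1..t}. irreducible (F i)"
    and "\<forall>i\<in>{1..t}. \<forall>j\<in>{1..t}. i \<noteq> j \<longrightarrow> \<not> (F i dvd F j \<and> F j dvd F i)"
    and "\<forall>i\<in>{1..t}. 1 \<le> h i"
    and "m = poly_ord (\<Prod>i\<in>{1..t}. F i)"
    and "\<forall>i\<in>{1..t}. \<exists>a. a \<noteq> 0 \<and> map_poly to_ac (F i) =
           smult (to_ac a) (\<Prod>\<eta>\<in>cyclotomic_coset q m (\<gamma> i). [:- (\<zeta> m powi \<eta>), 1:])"
    and "u = (LEAST v. \<forall>i\<in>{1..t}. h i \<le> p ^ v)"
    and "d = Gcd ((\<lambda>i. \<gamma> (i + 1) - \<gamma> i) ` {1..<t} \<union> {int m, int q - 1})"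
  shows "min_binomial_order f = p ^ u * (m div nat d) \<and>
    (\<forall>i\<in>{1..t}. map_poly to_ac (min_binomial_multiple f) =
       [:0, 1:] ^ (p ^ u * (m div nat d)) -
       [:\<zeta> m powi ((int (p ^ u) * \<gamma> i * int m) div d):])"
proof -
  let ?X = "[:0, 1:] :: 'a poly" and ?I = "{1..t}"
  define R where "R = (\<Prod>i\<in>?I. F i)"
  have char: "CHAR('a) = p"
    using CHAR_eq_if_card_eq_prime_power[of p e] assms(1-3) by simp
  have pchar: "prime CHAR('a)" "prime CHAR('a poly)"
    using char assms(1) by simp_all
  have "0 < p" "1 < p"
    using assms(1) prime_gt_0_nat prime_gt_1_nat by blast+

  \<comment> \<open>Prime factors, the radical \<open>R\<close> and its order\<close>
  have primeF: "prime_elem (F i)" if "i \<in> ?I" for i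
    using that assms(9) field_poly_irreducible_imp_prime by blast
  \<comment> \<open>The hypothesis only excludes associated factors; a non-unit divisor of an
    irreducible element is associated to it.\<close>
  have distinct: "\<not> F i dvd F j" if "i \<in> ?I" "j \<in> ?I" "i \<noteq> j" for i j
  proof
    assume "F i dvd F j"
    moreover have "\<not> is_unit (F i)"
      using primeF[OF that(1)] prime_elem_not_unit by blast
    ultimately have "F j dvd F i"
      using irreducibleD' assms(9) that by blast
    then show False
      using \<open>F i dvd F j\<close> assms(10) that by blast
  qed
  have f_dvd: "f dvd g" if "\<And>i. i \<in> ?I \<Longrightarrow> F i ^ h i dvd g" for g
    using prod_prime_elem_power_dvd[of ?I F h g] primeF distinct that assms(7,8)
    by (simp add: smult_dvd)
  have R_dvd: "R dvd g" if "\<And>i. i \<in> ?I \<Longrightarrow> F i dvd g" for g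
    using prod_prime_elem_power_dvd[of ?I F "\<lambda>_. 1" g] primeF distinct that
    by (simp add: R_def)
  have F_dvd_R: "F i dvd R" if "i \<in> ?I" for i
    using that by (simp add: R_def dvd_prodI)
  have Fh_dvd_f: "F i ^ h i dvd f" if "i \<in> ?I" for i
    unfolding assms(8) using that by (intro dvd_smult dvd_prodI) simp
  have F_dvd_f: "F i dvd f" if "i \<in> ?I" for i
    using Fh_dvd_f[OF that] assms(11) that by (meson dvd_power dvd_trans less_le_trans zero_less_one)
  have "R dvd f"
    using F_dvd_f by (rule R_dvd)
  then have R: "R \<noteq> 0" "coprime R ?X"
    using assms(5,6) coprime_divisors[of R f ?X ?X] by auto
  have m: "m = poly_ord R" "0 < m"
    using assms(12) poly_ord_pos[OF R] by (simp_all add: R_def)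
  have R_dvd_iff: "R dvd ?X ^ k - 1 \<longleftrightarrow> m dvd k" for k
    using poly_ord_dvd_iff[OF R] m(1) by simp

  \<comment> \<open>Coprimality of \<open>m\<close> and \<open>p\<close>, and the primitive
    \<open>m\<close>-th root of unity\<close>
  have "coprime m p"
  proof (rule ccontr)
    assume "\<not> coprime m p"
    then obtain k where k: "m = p * k"
      using assms(1) by (metis coprime_commute dvdE prime_imp_coprime)
    \<comment> \<open>By Frobenius this is a \<open>p\<close>-th power, so each prime
      \<open>F i\<close> already divides \<open>?X ^ k - 1\<close>; then \<open>m\<close> would
      divide the smaller number \<open>k\<close>.\<close>
    have "?X ^ m - 1 = (?X ^ k - 1) ^ p"
      using power_char_diff[OF pchar(2), of "?X ^ k" 1 1] char k
      by (simp add: mult.commute flip: power_mult)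
    then have "F i dvd (?X ^ k - 1) ^ p" if "i \<in> ?I" for i
      using F_dvd_R[OF that] R_dvd_iff[of m] by (metis dvd_refl dvd_trans)
    then have "F i dvd ?X ^ k - 1" if "i \<in> ?I" for i
      using primeF prime_elem_dvd_power that by blast
    then have "m dvd k"
      using R_dvd R_dvd_iff by blast
    then show False
      using k m(2) \<open>1 < p\<close> by (auto dest!: dvd_imp_le)
  qed
  then have "coprime m q"
    using assms(2) by simp
  then have prim: "primitive_root_of_unity m (\<zeta> m)"
    using assms(4) by (simp add: compatible_roots_of_unity_def)
  note powi_eq_iff = primitive_root_powi_eq_iff[OF prim]
  have zeta_power: "(\<zeta> m powi k) ^ n = \<zeta> m powi (k * int n)" for k n
    by (rule power_int_power')

  \<comment> \<open>Divisibility of binomials by \<open>F i\<close>, tested at one root\<close>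
  have root: "poly (map_poly to_ac (F i)) (\<zeta> m powi \<gamma> i) = 0" if "i \<in> ?I" for i
  proof -
    have "cyclotomic_coset q m (\<gamma> i) \<subseteq> {0..<int m}"
      using m(2) by (auto simp: cyclotomic_coset_def)
    then have "finite (cyclotomic_coset q m (\<gamma> i))"
      by (rule finite_subset) simp
    \<comment> \<open>The coset consists of reduced representatives, so \<open>\<gamma> i\<close>
      itself need not lie in it; the exponent 0 yields its residue.\<close>
    moreover have "\<gamma> i mod int m \<in> cyclotomic_coset q m (\<gamma> i)"
      by (auto simp: cyclotomic_coset_def intro!: exI[of _ 0])
    moreover have "\<zeta> m powi (\<gamma> i mod int m) = \<zeta> m powi \<gamma> i"
      using powi_eq_iff by (simp add: mod_eq_dvd_iff[symmetric])
    moreover obtain a where "map_poly to_ac (F i) =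
        smult (to_ac a) (\<Prod>\<eta>\<in>cyclotomic_coset q m (\<gamma> i). [:- (\<zeta> m powi \<eta>), 1:])"
      using assms(13) \<open>i \<in> ?I\<close> by blast
    ultimately show ?thesis
      by (auto simp: poly_prod intro!: bexI[of _ "\<gamma> i mod int m"])
  qed
  have F_dvd_iff: "F i dvd ?X ^ n - [:c:] \<longleftrightarrow> \<zeta> m powi (\<gamma> i * int n) = to_ac c"
    if "i \<in> ?I" for i n c
  proof -
    have "poly (map_poly to_ac (?X ^ n - [:c:])) (\<zeta> m powi \<gamma> i) = \<zeta> m powi (\<gamma> i * int n) - to_ac c"
      by (simp add: to_ac_poly_X_power_minus zeta_power)
    moreover have "F i dvd g \<longleftrightarrow> poly (map_poly to_ac g) (\<zeta> m powi \<gamma> i) = 0" for g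
      using root[OF that] irreducible_dvd_if_common_root[of "F i" _ g] assms(9) that
      by (auto simp: to_ac_poly_mult)
    ultimately show ?thesis
      by simp
  qed

  \<comment> \<open>The divisor \<open>d\<close> of \<open>m\<close> and the quotient
    \<open>s\<close>\<close>
  define D where "D = (\<lambda>i. \<gamma> (i + 1) - \<gamma> i) ` {1..<t} \<union> {int m, int q - 1}"
  have d: "d = Gcd D"
    unfolding D_def by fact
  have "0 < d" "d dvd int m" "d dvd int q - 1"
  proof -
    show dvd: "d dvd int m" "d dvd int q - 1"
      unfolding d by (intro Gcd_dvd; simp add: D_def)+
    have "0 \<le> d"
      unfolding d by (rule Gcd_int_greater_eq_0)
    moreover have "d \<noteq> 0"
      using dvd(1) m(2) by auto
    ultimately show "0 < d"
      by linarith
  qed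
  define s where "s = m div nat d"
  have "nat d dvd m"
    using \<open>0 < d\<close> \<open>d dvd int m\<close> by (simp add: nat_dvd_iff)
  then have "m = nat d * s" "0 < s"
    using m(2) by (auto simp: s_def)
  then have ds: "int m = d * int s"
    using \<open>0 < d\<close> by simp
  \<comment> \<open>\<open>D\<close> contains only differences of consecutive
    \<open>\<gamma> i\<close>; the others are obtained by telescoping from index 1.\<close>
  have d_diff: "d dvd \<gamma> i - \<gamma> 1" if "i \<in> ?I" for i
  proof -
    have "1 \<le> i" "i \<le> t"
      using that by auto
    then show ?thesis
    proof (induction i rule: dec_induct)
      case (step i)
      have "d dvd \<gamma> (i + 1) - \<gamma> i"
        unfolding d D_def using step by (intro Gcd_dvd) auto
      then have "d dvd (\<gamma> (i + 1) - \<gamma> i) + (\<gamma> i - \<gamma> 1)"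
        using step by (intro dvd_add) auto
      then show ?case
        by simp
    qed simp
  qed

  \<comment> \<open>The constant \<open>c\<close> in the base field\<close>
  have "(\<zeta> m powi (\<gamma> 1 * int s)) ^ (CARD('a) - 1) = 1"
  proof -
    have "int (q - 1) = int q - 1"
      using assms(2) \<open>0 < p\<close> by (simp add: of_nat_diff Suc_leI)
    \<comment> \<open>Here \<open>m = d * s\<close>, and \<open>d\<close> divides
      \<open>q - 1\<close>.\<close>
    then have "int m dvd \<gamma> 1 * int s * int (q - 1)"
      using \<open>d dvd int q - 1\<close> ds by (auto simp: ac_simps intro!: dvd_mult mult_dvd_mono)
    then show ?thesis
      by (simp only: zeta_power primitive_root_powi_eq_1_iff[OF prim] assms(3))
  qed
  then obtain c where c: "to_ac c = \<zeta> m powi (\<gamma> 1 * int s)"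
    by (metis in_range_to_ac_if_power_eq_1 rangeE)
  have c_eq: "to_ac c = \<zeta> m powi (\<gamma> i * int s)" if "i \<in> ?I" for i
  proof -
    \<comment> \<open>Since \<open>d * s = m\<close>, replacing index 1 by \<open>i\<close> changes
      the exponent by a multiple of \<open>m\<close> only.\<close>
    have "d * int s dvd (\<gamma> i - \<gamma> 1) * int s"
      using d_diff[OF that] by (rule mult_dvd_mono) simp
    then show ?thesis
      unfolding c using ds by (metis powi_eq_iff left_diff_distrib)
  qed
  have "\<zeta> m \<noteq> 0"
    using prim by (auto simp: primitive_root_of_unity_def power_0_left)
  then have "c \<noteq> 0"
    using c by auto

  \<comment> \<open>The binomial \<open>G\<close> as a multiple of \<open>f\<close>\<close>
  have h_le: "h i \<le> p ^ u" if "i \<in> ?I" for i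
  proof -
    \<comment> \<open>The sum of the multiplicities is a crude witness, by \<open>n < p ^ n\<close>,
      that some exponent satisfies the condition whose least solution is \<open>u\<close>.\<close>
    have "h i \<le> p ^ (\<Sum>j\<in>?I. h j)" if "i \<in> ?I" for i
    proof -
      have "h i \<le> (\<Sum>j\<in>?I. h j)"
        using that by (intro member_le_sum) simp_all
      also have "\<dots> < p ^ (\<Sum>j\<in>?I. h j)"
        using \<open>1 < p\<close> by (simp add: power_gt_expt)
      finally show ?thesis
        by (rule less_imp_le)
    qed
    then have "\<forall>i\<in>?I. h i \<le> p ^ u"
      unfolding assms(14) by (intro LeastI[of "\<lambda>v. \<forall>i\<in>?I. h i \<le> p ^ v"]) blast
    then show ?thesis
      using that by blast
  qed
  define G where "G = ?X ^ (p ^ u * s) - [:c ^ p ^ u:]"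
  \<comment> \<open>Frobenius exhibits \<open>G\<close> as a \<open>p ^ u\<close>-th power, so one
    factor \<open>F i\<close> of \<open>?X ^ s - [:c:]\<close> yields \<open>F i ^ h i\<close> in
    \<open>G\<close>.\<close>
  have G: "G = (?X ^ s - [:c:]) ^ p ^ u"
    using power_char_diff[OF pchar(2), of "?X ^ s" "[:c:]" u] char
    by (simp add: G_def mult.commute poly_const_pow flip: power_mult)
  have "f dvd G"
  proof (rule f_dvd)
    fix i assume "i \<in> ?I"
    then have "F i dvd ?X ^ s - [:c:]"
      using F_dvd_iff c_eq by simp
    then show "F i ^ h i dvd G"
      unfolding G using h_le[OF \<open>i \<in> ?I\<close>] by (meson dvd_power_le)
  qed
  have deg: "degree G = p ^ u * s"
    unfolding G_def using \<open>0 < s\<close> \<open>0 < p\<close> by (intro degree_binomial) simp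

  \<comment> \<open>Lower bound for the degree of a binomial multiple\<close>
  have lower: "p ^ u * s \<le> n" if n: "1 \<le> n" "a \<noteq> 0" "f dvd ?X ^ n - [:a:]" for n a
  proof -
    \<comment> \<open>The full \<open>p\<close>-part of \<open>n\<close> is split off; as
      \<open>p\<close> does not divide \<open>k\<close>, no square of a prime divides
      \<open>?g\<close> below.\<close>
    obtain v k where vk: "n = p ^ v * k" "\<not> p dvd k"
      using multiplicity_decompose'[of n p] n(1) assms(1)
      by (metis not_one_le_zero not_prime_unit)
    then have "0 < k"
      by (cases "k = 0") auto
    obtain b where b: "a = b ^ p ^ v"
      using surj_power_char[OF pchar(1), of v] char by (metis surjD)
    have "b \<noteq> 0"
      using n(2) b \<open>0 < p\<close> by auto
    let ?g = "?X ^ k - [:b:]"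
    have g: "?X ^ n - [:a:] = ?g ^ p ^ v"
      using power_char_diff[OF pchar(2), of "?X ^ k" "[:b:]" v] char
      by (simp add: vk b mult.commute poly_const_pow flip: power_mult)
    have "h i \<le> p ^ v" if "i \<in> ?I" for i
    proof (rule prime_elem_power_dvd_power_le[OF primeF[OF that]])
      show "\<not> F i ^ 2 dvd ?g"
        using square_not_dvd_X_power_minus[OF primeF[OF that]] \<open>b \<noteq> 0\<close> vk(2) char
        by (simp add: of_nat_eq_0_iff_char_dvd)
      show "F i ^ h i dvd ?g ^ p ^ v"
        using Fh_dvd_f[OF that] n(3) g by (metis dvd_trans)
    qed
    then have "u \<le> v"
      unfolding assms(14) by (intro Least_le) blast
    have F_dvd_g: "F i dvd ?g" if "i \<in> ?I" for i
      using F_dvd_f[OF that] n(3) g prime_elem_dvd_power[OF primeF[OF that]] by (metis dvd_trans)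
    have "int m dvd int k * x" if x: "x \<in> D" for x
    proof -
      consider i where "i \<in> {1..<t}" "x = \<gamma> (i + 1) - \<gamma> i" | "x = int m" | "x = int q - 1"
        using x unfolding D_def by blast
      then show ?thesis
      proof cases
        case 1
        then have "i \<in> ?I" "i + 1 \<in> ?I"
          by auto
        \<comment> \<open>Both sides equal \<open>to_ac b\<close>.\<close>
        then have "\<zeta> m powi (\<gamma> (i + 1) * int k) = \<zeta> m powi (\<gamma> i * int k)"
          using F_dvd_g F_dvd_iff by metis
        then show ?thesis
          unfolding 1(2) powi_eq_iff by (simp add: algebra_simps)
      next
        case 3
        \<comment> \<open>As \<open>b ^ (q - 1) = 1\<close>, the radical \<open>R\<close> divides
          \<open>?X ^ (k * (q - 1)) - 1\<close> along with \<open>?g\<close>, so the order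
          \<open>m\<close> divides the exponent.\<close>
        have "?g dvd (?X ^ k) ^ (q - 1) - [:b:] ^ (q - 1)"
          by (simp add: power_diff_sumr2)
        also have "\<dots> = ?X ^ (k * (q - 1)) - 1"
          using power_card_field[OF \<open>b \<noteq> 0\<close>] assms(3)
          by (simp add: poly_const_pow one_pCons flip: power_mult)
        finally have "m dvd k * (q - 1)"
          using R_dvd[OF F_dvd_g] R_dvd_iff dvd_trans by blast
        then have "int m dvd int k * int (q - 1)"
          by (metis of_nat_dvd_iff of_nat_mult)
        then show ?thesis
          using 3 assms(2) \<open>0 < p\<close> by (simp add: of_nat_diff Suc_leI)
      qed simp
    qed
    \<comment> \<open>Scaling \<open>D\<close> by \<open>k\<close> scales its gcd, so
      \<open>m = d * s\<close> divides \<open>k * d\<close>, and \<open>d\<close> cancels.\<close>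
    then have "int m dvd Gcd ((*) (int k) ` D)"
      by (intro Gcd_greatest) blast
    then have "int m dvd int k * d"
      unfolding Gcd_mult d by simp
    then have "int s dvd int k"
      using ds \<open>0 < d\<close> by (simp add: mult.commute)
    then have "s \<le> k"
      using \<open>0 < k\<close> by (simp add: dvd_imp_le)
    then show ?thesis
      using \<open>u \<le> v\<close> \<open>1 < p\<close> vk(1) by (simp add: mult_le_mono power_increasing)
  qed

  \<comment> \<open>Minimality of \<open>G\<close> and the constant expressed through any
    \<open>\<gamma> i\<close>\<close>
  have "is_min_binomial_multiple f G"
    unfolding is_min_binomial_multiple_def
  proof (intro conjI allI impI)
    show "binomial_poly G"
      unfolding binomial_poly_def G_def using \<open>0 < s\<close> \<open>0 < p\<close> \<open>c \<noteq> 0\<close>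
      by (intro exI[of _ "p ^ u * s"] exI[of _ "c ^ p ^ u"]) simp
    show "f dvd G"
      by fact
    show "degree G \<le> degree g" if g: "binomial_poly g \<and> f dvd g" for g
    proof -
      obtain n a where "1 \<le> n" "a \<noteq> 0" "g = ?X ^ n - [:a:]"
        using g unfolding binomial_poly_def by blast
      then show ?thesis
        using g lower[of n a] deg by (simp add: degree_binomial)
    qed
  qed
  then have min: "min_binomial_multiple f = G"
    unfolding min_binomial_multiple_def
    using is_min_binomial_multiple_ex1[OF assms(5,6)] by (rule the1_equality[rotated])
  have "map_poly to_ac G = [:0, 1:] ^ (p ^ u * s) - [:\<zeta> m powi ((int (p ^ u) * \<gamma> i * int m) div d):]"
    if "i \<in> ?I" for i
  proof -
    \<comment> \<open>The division is exact because \<open>d\<close> divides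
      \<open>m\<close>.\<close>
    have "(int (p ^ u) * \<gamma> i * int m) div d = \<gamma> i * int s * int (p ^ u)"
      using ds \<open>0 < d\<close> by (simp add: ac_simps)
    then have "\<zeta> m powi ((int (p ^ u) * \<gamma> i * int m) div d) = to_ac (c ^ p ^ u)"
      unfolding to_ac_power c_eq[OF that] zeta_power by simp
    then show ?thesis
      by (simp only: G_def to_ac_poly_X_power_minus)
  qed
  then show ?thesis
    using min deg by (simp add: min_binomial_order_def s_def)
qed

end
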